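(* There are groups in the class epiRegular (and thus in epiCF) that are not in the class $co\mathcal{CF}$.
   Context: For a set $X$, $X^*$ denotes the set of all finite strings over $X$, including the empty string. For a group $G$ and $X\subseteq G$, and $w\in X^*$, $g\in G$, write $w=_G g$ if the product in $G$ of the letters of $w$ equals $g$. For C equal to Regular or CF (context-free), a group $G$ is epiC if there are a finite set $X\subseteq G$ generating $G$ as a monoid and a language $L\subseteq X^*$ in the class C such that no $w\in L$ satisfies $w=_G 1_G$, and for every $h\in G\setminus\{1_G\}$ there is $w_h\in L$ with $w_h=_G h$. The class $co\mathcal{CF}$ consists of the finitely generated groups with context-free coword problem, i.e. those $G$ for which, with respect to a finite monoid generating set $X$, the language $coWP(G,X)=\{w\in X^*\mid w\neq_G 1_G\}$ is context-free (this property does not depend on the choice of finite monoid generating set). *)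

theory Defs
  imports "HOL-Algebra.Group"
begin

section \<open>Regular languages\<close>

text \<open>
  A nondeterministic finite automaton is given by a finite set of labelled transitions, a finite
  set of initial states and a finite set of final states.  Only finitely many states and letters
  matter, so states can be taken to be natural numbers and the alphabet need not be listed.
\<close>

inductive nfa_run :: "('q \<times> 'a \<times> 'q) set \<Rightarrow> 'q \<Rightarrow> 'a list \<Rightarrow> 'q \<Rightarrow> bool"
  for \<Delta> :: "('q \<times> 'a \<times> 'q) set" where
  run_Nil: "nfa_run \<Delta> p [] p"
| run_Cons: "(p, a, q) \<in> \<Delta> \<Longrightarrow> nfa_run \<Delta> q w r \<Longrightarrow> nfa_run \<Delta> p (a # w) r"

definition nfa_lang :: "('q \<times> 'a \<times> 'q) set \<Rightarrow> 'q set \<Rightarrow> 'q set \<Rightarrow> 'a list set" where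
  "nfa_lang \<Delta> I F = {w. \<exists>p\<in>I. \<exists>q\<in>F. nfa_run \<Delta> p w q}"

definition regular_language :: "'a list set \<Rightarrow> bool" where
  "regular_language L \<longleftrightarrow>
     (\<exists>(\<Delta> :: (nat \<times> 'a \<times> nat) set) I F.
        finite \<Delta> \<and> finite I \<and> finite F \<and> L = nfa_lang \<Delta> I F)"

section \<open>Context-free languages\<close>

datatype ('n, 't) sym = Nt 'n | Tm 't

type_synonym ('n, 't) prods = "('n \<times> ('n, 't) sym list) set"

inductive cfg_step :: "('n, 't) prods \<Rightarrow> ('n, 't) sym list \<Rightarrow> ('n, 't) sym list \<Rightarrow> bool"
  for P :: "('n, 't) prods" where
  "(A, \<alpha>) \<in> P \<Longrightarrow> cfg_step P (u @ [Nt A] @ v) (u @ \<alpha> @ v)"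

definition cfg_lang :: "('n, 't) prods \<Rightarrow> 'n \<Rightarrow> 't list set" where
  "cfg_lang P S = {w. (cfg_step P)\<^sup>*\<^sup>* [Nt S] (map Tm w)}"

text \<open>
  Finitely many productions involve only finitely many nonterminals, so natural numbers
  suffice as nonterminals.
\<close>

definition context_free_language :: "'a list set \<Rightarrow> bool" where
  "context_free_language L \<longleftrightarrow>
     (\<exists>(P :: (nat, 'a) prods) S. finite P \<and> L = cfg_lang P S)"

section \<open>Groups and words\<close>

text \<open>The letters of a word are group elements; \<open>word_value G w\<close> is their product in \<open>G\<close>.\<close>

definition word_value :: "('a, 'b) monoid_scheme \<Rightarrow> 'a list \<Rightarrow> 'a" where
  "word_value G w = foldr (\<otimes>\<^bsub>G\<^esub>) w \<one>\<^bsub>G\<^esub>"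

text \<open>Generation as a monoid: the inverse of a generator is a letter only if it belongs to \<open>X\<close> itself.\<close>

definition finite_monoid_gen_set :: "('a, 'b) monoid_scheme \<Rightarrow> 'a set \<Rightarrow> bool" where
  "finite_monoid_gen_set G X \<longleftrightarrow>
     finite X \<and> X \<subseteq> carrier G \<and> (\<forall>g\<in>carrier G. \<exists>w\<in>lists X. word_value G w = g)"

definition epi :: "('a list set \<Rightarrow> bool) \<Rightarrow> ('a, 'b) monoid_scheme \<Rightarrow> bool" where
  "epi \<C> G \<longleftrightarrow>
     (\<exists>X L. finite_monoid_gen_set G X \<and> L \<subseteq> lists X \<and> \<C> L \<and>
        (\<forall>w\<in>L. word_value G w \<noteq> \<one>\<^bsub>G\<^esub>) \<and>
        (\<forall>h\<in>carrier G - {\<one>\<^bsub>G\<^esub>}. \<exists>w\<in>L. word_value G w = h))"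

definition epi_regular :: "('a, 'b) monoid_scheme \<Rightarrow> bool" where
  "epi_regular G \<longleftrightarrow> epi regular_language G"

definition epi_CF :: "('a, 'b) monoid_scheme \<Rightarrow> bool" where
  "epi_CF G \<longleftrightarrow> epi context_free_language G"

definition coWP :: "('a, 'b) monoid_scheme \<Rightarrow> 'a set \<Rightarrow> 'a list set" where
  "coWP G X = {w \<in> lists X. word_value G w \<noteq> \<one>\<^bsub>G\<^esub>}"

text \<open>
  Context-freeness of \<open>coWP G X\<close> does not depend on the choice of \<open>X\<close>.  With the existential
  quantifier, finite generation is part of the definition, and its negation for a finitely
  generated group says that no finite monoid generating set has context-free coword problem.
\<close>

definition coCF :: "('a, 'b) monoid_scheme \<Rightarrow> bool" where
  "coCF G \<longleftrightarrow> (\<exists>X. finite_monoid_gen_set G X \<and> context_free_language (coWP G X))"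

end

theory Submission
  imports Defs "HOL-Library.Countable_Set" "HOL-Algebra.Weak_Morphisms"
begin

text \<open>
  The argument is one of cardinality.  There are only countably many context-free languages of
  words over \<open>\<nat>\<close>, so, for a fixed finite set of letters, only countably many languages can be
  coword problems of \<open>co\<C>\<F>\<close> groups containing these letters
  (\<open>countable_coWP_of_coCF\<close>).  It is enough to exhibit uncountably many epiRegular groups that
  share a carrier and finitely many letters and have pairwise different coword problems on
  those letters.

  The class epiRegular contains such families because it does not see how a central extension
  is twisted.  Let \<open>Q\<close> be the lamplighter group \<open>\<int>/2 \<wr> \<int>\<close>.  Every element of \<open>Q\<close> that lights some
  lamp is spelled by a single sweep from its leftmost lamp to its rightmost one, and a word of
  this shape can never represent the identity, since the leftmost lamp is lit exactly once.
  In an extension of \<open>Q\<close> by a central \<open>z\<close> of order \<open>2\<close>, the same words, with an optional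
  \<open>z\<close> appended, still reach every element that lights a lamp, and the remaining elements
  \<open>z\<^sup>c t\<^sup>k\<close> are spelled directly.  One finite automaton therefore serves all the extensions
  (\<open>epi_regular_lamp_ext\<close>).

  The relations of \<open>Q\<close> saying that two lamps commute can be broken independently for each distance
  between the lamps, which gives uncountably many extensions.  With \<open>a\<^sub>i\<close> denoting the lamp at
  position \<open>i\<close>, for each set \<open>T\<close> of natural numbers there is one in which
  \<open>a\<^sub>d\<close> and \<open>a\<^sub>0\<close>, for \<open>d \<ge> 1\<close>, commute if and only if \<open>d - 1 \<notin> T\<close>, and otherwise commute
  only up to \<open>z\<close>.  Its coword problem determines \<open>T\<close> (\<open>inj_coWP_lamp_ext\<close>).  This is a variant
  of P. Hall's construction of uncountably many finitely generated soluble groups.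
\<close>

section \<open>Countability of the possible coword problems\<close>

lemma (in monoid) word_value_closed:
  "w \<in> lists (carrier G) \<Longrightarrow> word_value G w \<in> carrier G"
  by (induction w) (auto simp: word_value_def)

lemma (in monoid) word_value_append:
  assumes "v \<in> lists (carrier G)" "w \<in> lists (carrier G)"
  shows "word_value G (v @ w) = word_value G v \<otimes> word_value G w"
  using assms
proof (induction v)
  case Nil
  then show ?case using word_value_closed[of w] by (simp add: word_value_def)
next
  case (Cons x v)
  then have "x \<in> carrier G" "word_value G v \<in> carrier G" "word_value G w \<in> carrier G"
    and "word_value G (v @ w) = word_value G v \<otimes> word_value G w"
    using word_value_closed by auto
  then show ?case by (simp add: word_value_def m_assoc)
qed

lemma (in monoid) word_value_concat:
  assumes "w \<in> lists Y" "Y \<subseteq> carrier G"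
    and "\<And>y. y \<in> Y \<Longrightarrow> u y \<in> lists (carrier G) \<and> word_value G (u y) = y"
  shows "word_value G (concat (map u w)) = word_value G w"
  using assms(1)
proof (induction w)
  case (Cons y w)
  have "concat (map u w) \<in> lists (carrier G)"
    using Cons.hyps assms(3) by fastforce
  with Cons assms show ?case
    by (simp add: word_value_append) (simp add: word_value_def)
qed (simp add: word_value_def)

instance sym :: (countable, countable) countable
  by countable_datatype

lemma countable_context_free_languages:
  "countable {L :: 'a::countable list set. context_free_language L}"
proof -
  have "{L :: 'a list set. context_free_language L}
      \<subseteq> (\<lambda>(P :: (nat, 'a) prods, S). cfg_lang P S) ` (Collect finite \<times> UNIV)"
  proof
    fix L :: "'a list set" assume "L \<in> {L. context_free_language L}"
    then obtain P :: "(nat, 'a) prods" and S where "finite P" "L = cfg_lang P S"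
      by (auto simp: context_free_language_def)
    then show "L \<in> (\<lambda>(P :: (nat, 'a) prods, S). cfg_lang P S) ` (Collect finite \<times> UNIV)"
      by (intro image_eqI[of _ _ "(P, S)"]) auto
  qed
  moreover have "countable ((\<lambda>(P :: (nat, 'a) prods, S). cfg_lang P S) ` (Collect finite \<times> UNIV))"
    by (intro countable_image countable_SIGMA countable_Collect_finite) auto
  ultimately show ?thesis by (rule countable_subset)
qed

text \<open>
  Rewriting each letter of \<open>Y\<close> as a word over the generating set that witnesses \<^term>\<open>coCF G\<close>
  turns membership in \<^term>\<open>coWP G Y\<close> into membership in a context-free language.  The set
  \<^term>\<open>coWP G Y\<close> is therefore described by a context-free language together with a finite
  substitution table, and there are only countably many such descriptions.  The order of the
  quantifiers matters: one countable set serves all groups at once, so an uncountable family of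
  coword problems must leave it.
\<close>

lemma countable_coWP_of_coCF:
  fixes Y :: "'a::countable set"
  assumes "finite Y"
  shows "\<exists>\<D>. countable \<D> \<and>
           (\<forall>G :: 'a monoid. monoid G \<and> Y \<subseteq> carrier G \<and> coCF G \<longrightarrow> coWP G Y \<in> \<D>)"
proof -
  define code where
    "code = (\<lambda>(L :: 'a list set, m). {w \<in> lists Y. concat (map (\<lambda>y. the (map_of m y)) w) \<in> L})"
  have "countable (code ` ({L. context_free_language L} \<times> UNIV))"
    by (intro countable_image countable_SIGMA countable_context_free_languages) auto
  moreover have "coWP G Y \<in> code ` ({L. context_free_language L} \<times> UNIV)"
    if G: "monoid G" "Y \<subseteq> carrier G" "coCF G" for G :: "'a monoid"
  proof -
    interpret monoid G by fact
    obtain X where X: "finite_monoid_gen_set G X" "context_free_language (coWP G X)"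
      using G(3) by (auto simp: coCF_def)
    have "\<forall>y\<in>Y. \<exists>w. w \<in> lists X \<and> word_value G w = y"
      using X(1) G(2) unfolding finite_monoid_gen_set_def by blast
    then obtain u where u: "\<And>y. y \<in> Y \<Longrightarrow> u y \<in> lists X \<and> word_value G (u y) = y"
      by metis
    obtain ys where ys: "set ys = Y" using finite_list[OF assms] by auto
    define m where "m = map (\<lambda>y. (y, u y)) ys"
    have m: "the (map_of m y) = u y" if "y \<in> Y" for y
      using that ys by (simp add: m_def map_of_map_restrict)
    have "lists X \<subseteq> lists (carrier G)"
      using X(1) by (auto simp: finite_monoid_gen_set_def)
    then have val: "word_value G (concat (map u w)) = word_value G w" if "w \<in> lists Y" for w
      using word_value_concat[OF that G(2)] u by blast
    have in_X: "concat (map u w) \<in> lists X" if "w \<in> lists Y" for w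
      using that u by fastforce
    have table: "map (\<lambda>y. the (map_of m y)) w = map u w" if "w \<in> lists Y" for w
      using that m by auto
    have "concat (map (\<lambda>y. the (map_of m y)) w) \<in> coWP G X \<longleftrightarrow> word_value G w \<noteq> \<one>\<^bsub>G\<^esub>"
      if "w \<in> lists Y" for w
      using in_X[OF that] val[OF that] unfolding table[OF that] by (simp add: coWP_def)
    then have "coWP G Y = code (coWP G X, m)"
      unfolding code_def prod.case by (auto simp only: coWP_def)
    with X(2) show ?thesis by blast
  qed
  ultimately show ?thesis by blast
qed

section \<open>Regular languages are context-free\<close>

text \<open>
  The sentential forms of a right-linear grammar carry their only nonterminal at the end, so a
  derivation step has only one place to act.
\<close>

lemma map_Tm_Nt_eq_iff:
  "map Tm u @ [Nt p] = v @ Nt A # v' \<longleftrightarrow> v = map Tm u \<and> A = p \<and> v' = []"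
proof (induction u arbitrary: v)
  case Nil
  then show ?case by (cases v) auto
next
  case (Cons a u)
  then show ?case by (cases v) auto
qed

lemma map_Tm_neq_Nt: "map Tm u \<noteq> v @ Nt A # v'"
proof
  assume "map Tm u = v @ Nt A # v'"
  then have "Nt A \<in> set (map Tm u)" by simp
  then show False by auto
qed

lemma regular_imp_context_free:
  assumes "regular_language L"
  shows "context_free_language L"
proof -
  obtain \<Delta> :: "(nat \<times> 'a \<times> nat) set" and I F
    where fin: "finite \<Delta>" "finite I" "finite F" and L: "L = nfa_lang \<Delta> I F"
    using assms by (auto simp: regular_language_def)
  \<comment> \<open>Right-linear grammar: state \<open>p\<close> becomes the nonterminal \<open>Suc p\<close>, and \<open>0\<close> is the start symbol.\<close>
  define P :: "(nat, 'a) prods" where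
    "P = (\<lambda>p. (0, [Nt (Suc p)])) ` I
       \<union> (\<lambda>(p, a, q). (Suc p, [Tm a, Nt (Suc q)])) ` \<Delta>
       \<union> (\<lambda>q. (Suc q, [])) ` F"
  have "finite P" using fin by (simp add: P_def)
  have P_step: "cfg_step P (u @ [Nt A]) (u @ \<alpha>)" if "(A, \<alpha>) \<in> P" for A \<alpha> u
    using cfg_step.intros[OF that, of u "[]"] by simp
  have run_derives: "(cfg_step P)\<^sup>*\<^sup>* (map Tm u @ [Nt (Suc p)]) (map Tm (u @ w))"
    if "nfa_run \<Delta> p w q" "q \<in> F" for p w q u
    using that
  proof (induction arbitrary: u rule: nfa_run.induct)
    case (run_Nil p)
    then have "(Suc p, []) \<in> P" by (auto simp: P_def)
    from P_step[OF this, of "map Tm u"] show ?case by auto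
  next
    case (run_Cons p a q w r)
    then have "(Suc p, [Tm a, Nt (Suc q)]) \<in> P" by (force simp: P_def)
    from P_step[OF this, of "map Tm u"] run_Cons.IH[OF run_Cons.prems, of "u @ [a]"]
    show ?case by (simp add: converse_rtranclp_into_rtranclp)
  qed
  \<comment> \<open>The induction peels steps off the front of a derivation, so that a run grows at its front, as
    \<open>nfa_run\<close> does.  The three clauses are the shapes of sentential forms that can occur.\<close>
  have derives_run:
    "(\<forall>u. x = map Tm u \<longrightarrow> u = w) \<and>
     (\<forall>u p. x = map Tm u @ [Nt (Suc p)] \<longrightarrow> (\<exists>v. w = u @ v \<and> (\<exists>q\<in>F. nfa_run \<Delta> p v q))) \<and>
     (x = [Nt 0] \<longrightarrow> w \<in> nfa_lang \<Delta> I F)"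
    if "(cfg_step P)\<^sup>*\<^sup>* x (map Tm w)" for x w
    using that
  proof (induction rule: converse_rtranclp_induct)
    case base
    have "map Tm u = map Tm w \<longrightarrow> u = w" for u :: "'a list"
      by (auto simp: inj_map_eq_map inj_def)
    moreover have "map Tm w \<noteq> map Tm u @ [Nt (Suc p)]" for u :: "'a list" and p
      by (simp add: map_Tm_neq_Nt)
    moreover have "map Tm w \<noteq> [Nt (0::nat)]" by auto
    ultimately show ?case by metis
  next
    case (step x y)
    from step.hyps(1) obtain A \<alpha> v v' where
      x: "x = v @ Nt A # v'" and y: "y = v @ \<alpha> @ v'" and A: "(A, \<alpha>) \<in> P"
      by (auto elim!: cfg_step.cases)
    have "\<exists>v. w = u @ v \<and> (\<exists>q\<in>F. nfa_run \<Delta> p v q)" if xu: "x = map Tm u @ [Nt (Suc p)]" for u p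
    proof -
      have v: "v = map Tm u" "A = Suc p" "v' = []"
        using xu x map_Tm_Nt_eq_iff[of u "Suc p" v A v'] by auto
      from A v(2) consider "\<alpha> = []" "p \<in> F"
        | a q where "(p, a, q) \<in> \<Delta>" "\<alpha> = [Tm a, Nt (Suc q)]"
        by (auto simp: P_def)
      then show ?thesis
      proof cases
        case 1
        then have "u = w" using step.IH y v by auto
        with 1 show ?thesis by (auto intro: nfa_run.run_Nil)
      next
        case 2
        then have "y = map Tm (u @ [a]) @ [Nt (Suc q)]" using y v by simp
        with step.IH obtain v q' where "w = (u @ [a]) @ v" "q' \<in> F" "nfa_run \<Delta> q v q'" by blast
        with 2 show ?thesis by (auto intro!: exI[of _ "a # v"] intro: nfa_run.run_Cons)
      qed
    qed
    moreover have "w \<in> nfa_lang \<Delta> I F" if x0: "x = [Nt 0]"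
    proof -
      have v: "v = []" "A = 0" "v' = []"
        using x0 x map_Tm_Nt_eq_iff[of "[]" 0 v A v'] by auto
      then obtain p where "p \<in> I" "\<alpha> = [Nt (Suc p)]" using A by (auto simp: P_def)
      then have "y = map Tm [] @ [Nt (Suc p)]" using y v by simp
      with step.IH obtain q where "q \<in> F" "nfa_run \<Delta> p w q" by fastforce
      with \<open>p \<in> I\<close> show ?thesis by (auto simp: nfa_lang_def)
    qed
    ultimately show ?case using x map_Tm_neq_Nt by metis
  qed
  have "L = cfg_lang P 0"
  proof (intro equalityI subsetI)
    fix w assume "w \<in> L"
    then obtain p q where pq: "p \<in> I" "q \<in> F" "nfa_run \<Delta> p w q"
      by (auto simp: L nfa_lang_def)
    have "cfg_step P [Nt 0] [Nt (Suc p)]"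
      using P_step[of 0 "[Nt (Suc p)]" "[]"] pq(1) by (auto simp: P_def)
    with run_derives[OF pq(3,2), of "[]"] show "w \<in> cfg_lang P 0"
      by (simp add: cfg_lang_def converse_rtranclp_into_rtranclp)
  next
    fix w assume "w \<in> cfg_lang P 0"
    then show "w \<in> L" using derives_run[of "[Nt 0]" w] by (simp add: cfg_lang_def L)
  qed
  with \<open>finite P\<close> show ?thesis by (auto simp: context_free_language_def)
qed

lemma epi_regular_imp_epi_CF: "epi_regular G \<Longrightarrow> epi_CF G"
  unfolding epi_regular_def epi_CF_def epi_def using regular_imp_context_free by blast

section \<open>Automata reading group elements\<close>

text \<open>
  The group elements spelled by the words accepted from a given state.  With this predicate, both
  soundness and completeness of an automaton become inductions on group elements in which words
  do not occur.
\<close>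

inductive spelled ::
    "('a, 'b) monoid_scheme \<Rightarrow> ('q \<times> 'a \<times> 'q) set \<Rightarrow> 'q set \<Rightarrow> 'q \<Rightarrow> 'a \<Rightarrow> bool"
  for G \<Delta> F where
  spelled_final: "q \<in> F \<Longrightarrow> spelled G \<Delta> F q \<one>\<^bsub>G\<^esub>"
| spelled_step: "(p, x, q) \<in> \<Delta> \<Longrightarrow> spelled G \<Delta> F q g \<Longrightarrow> spelled G \<Delta> F p (x \<otimes>\<^bsub>G\<^esub> g)"

lemma nfa_run_imp_spelled:
  "nfa_run \<Delta> p w q \<Longrightarrow> q \<in> F \<Longrightarrow> spelled G \<Delta> F p (word_value G w)"
  by (induction rule: nfa_run.induct) (auto simp: word_value_def intro: spelled.intros)

lemma spelled_imp_nfa_run: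
  "spelled G \<Delta> F p g \<Longrightarrow> \<exists>w. \<exists>q\<in>F. nfa_run \<Delta> p w q \<and> word_value G w = g"
proof (induction rule: spelled.induct)
  case (spelled_final q)
  then show ?case
    by (intro exI[of _ "[]"] bexI[of _ q]) (auto simp: word_value_def intro: nfa_run.run_Nil)
next
  case (spelled_step p x q g)
  then obtain w r where "r \<in> F" "nfa_run \<Delta> q w r" "word_value G w = g" by blast
  with spelled_step.hyps show ?case
    by (intro exI[of _ "x # w"] bexI[of _ r]) (auto simp: word_value_def intro: nfa_run.run_Cons)
qed

lemma nfa_run_letters: "nfa_run \<Delta> p w q \<Longrightarrow> w \<in> lists ((fst \<circ> snd) ` \<Delta>)"
  by (induction rule: nfa_run.induct) force+

text \<open>
  The labels of the automaton generate the group: the accepted words spell every nontrivial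
  element, and the empty word spells the identity.
\<close>

lemma epi_regularI:
  fixes \<Delta> :: "(nat \<times> 'a \<times> nat) set"
  assumes fin: "finite \<Delta>" "finite I" "finite F"
    and labels: "\<And>p x q. (p, x, q) \<in> \<Delta> \<Longrightarrow> x \<in> carrier G"
    and sound: "\<And>p. p \<in> I \<Longrightarrow> \<not> spelled G \<Delta> F p \<one>\<^bsub>G\<^esub>"
    and complete: "\<And>g. g \<in> carrier G \<Longrightarrow> g \<noteq> \<one>\<^bsub>G\<^esub> \<Longrightarrow> \<exists>p\<in>I. spelled G \<Delta> F p g"
  shows "epi_regular G"
proof -
  let ?X = "(fst \<circ> snd) ` \<Delta>" and ?L = "nfa_lang \<Delta> I F"
  have sub: "?L \<subseteq> lists ?X"
    using nfa_run_letters by (fastforce simp: nfa_lang_def)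
  have no_one: "\<forall>w\<in>?L. word_value G w \<noteq> \<one>\<^bsub>G\<^esub>"
    using nfa_run_imp_spelled[of \<Delta> _ _ _ F G] sound by (fastforce simp: nfa_lang_def)
  have covers: "\<forall>h\<in>carrier G - {\<one>\<^bsub>G\<^esub>}. \<exists>w\<in>?L. word_value G w = h"
    using complete spelled_imp_nfa_run[of G \<Delta> F] by (fastforce simp: nfa_lang_def)
  have "\<exists>w\<in>lists ?X. word_value G w = g" if "g \<in> carrier G" for g
  proof (cases "g = \<one>\<^bsub>G\<^esub>")
    case True
    then show ?thesis by (intro bexI[of _ "[]"]) (auto simp: word_value_def)
  next
    case False
    then show ?thesis using covers sub that by blast
  qed
  then have "finite_monoid_gen_set G ?X"
    using fin labels by (auto simp: finite_monoid_gen_set_def)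
  moreover have "regular_language ?L" using fin by (auto simp: regular_language_def)
  ultimately show ?thesis
    unfolding epi_regular_def epi_def using sub no_one covers by blast
qed

lemma regular_language_map:
  assumes "regular_language L"
  shows "regular_language (map f ` L)"
proof -
  obtain \<Delta> :: "(nat \<times> 'a \<times> nat) set" and I F
    where fin: "finite \<Delta>" "finite I" "finite F" and L: "L = nfa_lang \<Delta> I F"
    using assms by (auto simp: regular_language_def)
  let ?\<Delta> = "(\<lambda>(p, a, q). (p, f a, q)) ` \<Delta>"
  have "nfa_run ?\<Delta> p (map f w) q" if "nfa_run \<Delta> p w q" for p w q
    using that by induction (force intro: nfa_run.intros)+
  moreover have "\<exists>w. v = map f w \<and> nfa_run \<Delta> p w q" if "nfa_run ?\<Delta> p v q" for p v q
    using that
  proof induction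
    case (run_Nil p)
    then show ?case by (auto intro: nfa_run.intros)
  next
    case (run_Cons p b q v r)
    then obtain a w where "(p, a, q) \<in> \<Delta>" "b = f a" "v = map f w" "nfa_run \<Delta> q w r" by auto
    then show ?case by (intro exI[of _ "a # w"]) (auto intro: nfa_run.intros)
  qed
  ultimately have "map f ` L = nfa_lang ?\<Delta> I F"
    by (auto simp: L nfa_lang_def image_iff) blast+
  then show ?thesis using fin unfolding regular_language_def by blast
qed

lemma word_value_iso:
  assumes "monoid G" "h \<in> iso G H" "h \<one>\<^bsub>G\<^esub> = \<one>\<^bsub>H\<^esub>" "w \<in> lists (carrier G)"
  shows "word_value H (map h w) = h (word_value G w)"
  using assms(4)
proof (induction w)
  case (Cons x w)
  then show ?case
    using monoid.word_value_closed[OF assms(1), of w] assms(2)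
    by (auto simp: word_value_def iso_def hom_def)
qed (simp add: word_value_def assms(3))

lemma epi_regular_iso:
  assumes G: "group G" and H: "group H" and h: "h \<in> iso G H" and epi: "epi_regular G"
  shows "epi_regular H"
proof -
  have one: "h \<one>\<^bsub>G\<^esub> = \<one>\<^bsub>H\<^esub>"
    using h G H by (auto simp: iso_def intro: hom_one)
  have bij: "bij_betw h (carrier G) (carrier H)" using h by (simp add: iso_def)
  obtain X L where X: "finite_monoid_gen_set G X" and L: "L \<subseteq> lists X" "regular_language L"
    "\<forall>w\<in>L. word_value G w \<noteq> \<one>\<^bsub>G\<^esub>"
    "\<forall>g\<in>carrier G - {\<one>\<^bsub>G\<^esub>}. \<exists>w\<in>L. word_value G w = g"
    using epi by (auto simp: epi_regular_def epi_def)
  have XG: "X \<subseteq> carrier G" using X by (simp add: finite_monoid_gen_set_def)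
  have G': "monoid G" using G by (simp add: group_def)
  have val: "word_value H (map h w) = h (word_value G w)" if "w \<in> lists X" for w
    using word_value_iso[OF G' h one] that XG by blast
  have val_in: "word_value G w \<in> carrier G" if "w \<in> lists X" for w
    using monoid.word_value_closed[OF G'] that XG by blast
  have onto: "\<exists>g\<in>carrier G. y = h g" if "y \<in> carrier H" for y
    using bij that by (auto simp: bij_betw_def)
  have h_eq: "h g = \<one>\<^bsub>H\<^esub> \<longleftrightarrow> g = \<one>\<^bsub>G\<^esub>" if "g \<in> carrier G" for g
    using bij that one monoid.one_closed[OF G'] by (metis bij_betw_def inj_onD)
  have "finite_monoid_gen_set H (h ` X)"
    unfolding finite_monoid_gen_set_def
  proof (intro conjI ballI)
    show "finite (h ` X)" using X by (simp add: finite_monoid_gen_set_def)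
    show "h ` X \<subseteq> carrier H" using XG bij by (auto simp: bij_betw_def)
    fix y assume "y \<in> carrier H"
    then obtain g where g: "g \<in> carrier G" "y = h g" using onto by blast
    then obtain w where "w \<in> lists X" "word_value G w = g"
      using X unfolding finite_monoid_gen_set_def by blast
    with g val show "\<exists>w\<in>lists (h ` X). word_value H w = y"
      by (intro bexI[of _ "map h w"]) auto
  qed
  moreover have "map h ` L \<subseteq> lists (h ` X)" using L(1) by (auto simp: lists_image)
  moreover have "\<forall>v\<in>map h ` L. word_value H v \<noteq> \<one>\<^bsub>H\<^esub>"
  proof (rule ballI, elim imageE)
    fix v w assume "v = map h w" "w \<in> L"
    moreover from this(2) L(1) have "w \<in> lists X" by blast
    ultimately show "word_value H v \<noteq> \<one>\<^bsub>H\<^esub>" using L(3) by (simp add: val val_in h_eq)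
  qed
  moreover have "\<forall>y\<in>carrier H - {\<one>\<^bsub>H\<^esub>}. \<exists>v\<in>map h ` L. word_value H v = y"
  proof
    fix y assume y: "y \<in> carrier H - {\<one>\<^bsub>H\<^esub>}"
    then obtain g where g: "g \<in> carrier G" "y = h g" using onto by blast
    then obtain w where "w \<in> L" "word_value G w = g" using L(4) y one by auto
    moreover from this(1) L(1) have "w \<in> lists X" by blast
    ultimately show "\<exists>v\<in>map h ` L. word_value H v = y"
      using g val by (intro bexI[of _ "map h w"]) simp_all
  qed
  ultimately show ?thesis
    unfolding epi_regular_def epi_def using regular_language_map[OF L(2)] by blast
qed

section \<open>Central extensions of the lamplighter group\<close>

definition shift :: "int \<Rightarrow> int set \<Rightarrow> int set" where
  "shift k A = {i. i - k \<in> A}"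

lemma mem_shift [simp]: "i \<in> shift k A \<longleftrightarrow> i - k \<in> A"
  by (simp add: shift_def)

lemma shift_0 [simp]: "shift 0 A = A"
  by (simp add: shift_def)

lemma shift_shift [simp]: "shift k (shift l A) = shift (k + l) A"
  by (auto simp: algebra_simps)

lemma shift_empty [simp]: "shift k {} = {}"
  by (simp add: shift_def)

lemma shift_insert [simp]: "shift k (insert i A) = insert (i + k) (shift k A)"
  by auto

lemma shift_sym_diff: "shift k (sym_diff A B) = sym_diff (shift k A) (shift k B)"
  by auto

lemma shift_eq_image: "shift k A = (\<lambda>i. i + k) ` A"
proof (intro equalityI subsetI)
  fix i assume "i \<in> shift k A"
  then show "i \<in> (\<lambda>i. i + k) ` A" by (intro image_eqI[of _ _ "i - k"]) auto
qed auto

lemma finite_shift [simp]: "finite (shift k A) \<longleftrightarrow> finite A"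
  by (simp add: shift_eq_image finite_image_iff)

lemma shift_eq_empty [simp]: "shift k A = {} \<longleftrightarrow> A = {}"
  by (simp add: shift_eq_image)

text \<open>
  Finite sets of integers under symmetric difference form the \<open>\<int>/2\<close>-vector space with basis
  \<open>{e\<^sub>i | i \<in> \<int>}\<close>.  On it, \<open>cocycle T\<close> is the bilinear form that pairs \<open>e\<^sub>i\<close> with \<open>e\<^sub>j\<close> to \<open>1\<close>
  exactly when \<open>i - j - 1\<close> is a member of \<open>T\<close>.  Bilinear forms are 2-cocycles, whatever \<open>T\<close> is, and
  dependence on \<open>i - j\<close> alone makes this one invariant under the movement of the cursor.  Only pairs
  with \<open>i > j\<close> are linked, so the lamps at \<open>i\<close> and \<open>j\<close> fail to commute in the extension exactly
  when they are linked in one of the two orders.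
\<close>

definition linked_pairs :: "nat set \<Rightarrow> int set \<Rightarrow> int set \<Rightarrow> (int \<times> int) set" where
  "linked_pairs T A B = {(i, j) \<in> A \<times> B. \<exists>n\<in>T. i = j + int n + 1}"

definition cocycle :: "nat set \<Rightarrow> int set \<Rightarrow> int set \<Rightarrow> bool" where
  "cocycle T A B = odd (card (linked_pairs T A B))"

lemma finite_linked_pairs: "finite A \<Longrightarrow> finite B \<Longrightarrow> finite (linked_pairs T A B)"
  by (rule finite_subset[of _ "A \<times> B"]) (auto simp: linked_pairs_def)

lemma odd_card_sym_diff:
  assumes "finite A" "finite B"
  shows "odd (card (sym_diff A B)) \<longleftrightarrow> odd (card A) \<noteq> odd (card B)"
proof -
  have "card (sym_diff A B) = card (A - B) + card (B - A)"
    using assms by (intro card_Un_disjoint) auto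
  moreover have "card A = card (A - B) + card (A \<inter> B)"
    using card_Int_Diff[OF assms(1), of B] by simp
  moreover have "card B = card (B - A) + card (A \<inter> B)"
    using card_Int_Diff[OF assms(2), of A] by (simp add: Int_commute)
  ultimately show ?thesis by presburger
qed

lemma cocycle_sym_diff_left:
  assumes "finite A" "finite B" "finite C"
  shows "cocycle T (sym_diff A B) C \<longleftrightarrow> cocycle T A C \<noteq> cocycle T B C"
proof -
  have "linked_pairs T (sym_diff A B) C = sym_diff (linked_pairs T A C) (linked_pairs T B C)"
    unfolding linked_pairs_def by blast
  then show ?thesis
    unfolding cocycle_def using assms by (simp only: odd_card_sym_diff finite_linked_pairs)
qed

lemma cocycle_sym_diff_right:
  assumes "finite A" "finite B" "finite C"
  shows "cocycle T A (sym_diff B C) \<longleftrightarrow> cocycle T A B \<noteq> cocycle T A C"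
proof -
  have "linked_pairs T A (sym_diff B C) = sym_diff (linked_pairs T A B) (linked_pairs T A C)"
    unfolding linked_pairs_def by blast
  then show ?thesis
    unfolding cocycle_def using assms by (simp only: odd_card_sym_diff finite_linked_pairs)
qed

lemma cocycle_shift [simp]: "cocycle T (shift k A) (shift k B) = cocycle T A B"
proof -
  have "bij_betw (\<lambda>(i, j). (i + k, j + k)) (linked_pairs T A B)
     (linked_pairs T (shift k A) (shift k B))"
    by (rule bij_betw_byWitness[where f' = "\<lambda>(i, j). (i - k, j - k)"])
      (auto simp: linked_pairs_def)
  then show ?thesis unfolding cocycle_def by (metis bij_betw_same_card)
qed

lemma cocycle_empty [simp]: "cocycle T {} B = False" "cocycle T A {} = False"
  by (simp_all add: cocycle_def linked_pairs_def)

text \<open>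
  In \<open>(A, c, k)\<close>, the set \<open>A\<close> contains the positions of the lit lamps, \<open>k\<close> is the position of the
  cursor, and \<open>c\<close> is the exponent of the central element of order \<open>2\<close>; addition modulo \<open>2\<close> is
  inequality of truth values.
\<close>

definition lamp_ext :: "nat set \<Rightarrow> (int set \<times> bool \<times> int) monoid" where
  "lamp_ext T = \<lparr>carrier = {(A, c, k). finite A},
     mult = (\<lambda>(A, c, k) (B, d, l).
       (sym_diff A (shift k B), (c \<noteq> d) \<noteq> cocycle T A (shift k B), k + l)),
     one = ({}, False, 0)\<rparr>"

lemma lamp_ext_simps [simp]:
  "(A, c, k) \<in> carrier (lamp_ext T) \<longleftrightarrow> finite A"
  "(A, c, k) \<otimes>\<^bsub>lamp_ext T\<^esub> (B, d, l) =
     (sym_diff A (shift k B), (c \<noteq> d) \<noteq> cocycle T A (shift k B), k + l)"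
  "\<one>\<^bsub>lamp_ext T\<^esub> = ({}, False, 0)"
  by (simp_all add: lamp_ext_def)

lemma group_lamp_ext: "group (lamp_ext T)"
proof (rule groupI)
  fix x y z
  assume xyz: "x \<in> carrier (lamp_ext T)" "y \<in> carrier (lamp_ext T)" "z \<in> carrier (lamp_ext T)"
  obtain A c k where x: "x = (A, c, k)" by (cases x)
  obtain B d l where y: "y = (B, d, l)" by (cases y)
  obtain C e m where z: "z = (C, e, m)" by (cases z)
  have f: "finite A" "finite B" "finite C" using xyz by (auto simp: x y z)
  have c1: "cocycle T (sym_diff A (shift k B)) (shift (k + l) C)
      \<longleftrightarrow> cocycle T A (shift (k + l) C) \<noteq> cocycle T B (shift l C)"
    using f cocycle_sym_diff_left[of A "shift k B" "shift (k + l) C" T]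
      cocycle_shift[of T k B "shift l C"] by simp
  have c2: "cocycle T A (shift k (sym_diff B (shift l C)))
      \<longleftrightarrow> cocycle T A (shift k B) \<noteq> cocycle T A (shift (k + l) C)"
    using f cocycle_sym_diff_right[of A "shift k B" "shift (k + l) C" T]
    by (simp only: shift_sym_diff shift_shift finite_shift)
  have s: "sym_diff (sym_diff A (shift k B)) (shift (k + l) C)
      = sym_diff A (shift k (sym_diff B (shift l C)))"
    by (simp only: shift_sym_diff shift_shift) blast
  show "x \<otimes>\<^bsub>lamp_ext T\<^esub> y \<otimes>\<^bsub>lamp_ext T\<^esub> z = x \<otimes>\<^bsub>lamp_ext T\<^esub> (y \<otimes>\<^bsub>lamp_ext T\<^esub> z)"
    unfolding x y z lamp_ext_simps c1 c2 s by auto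
next
  fix x assume x: "x \<in> carrier (lamp_ext T)"
  obtain A c k where A: "x = (A, c, k)" by (cases x)
  show "\<exists>y\<in>carrier (lamp_ext T). y \<otimes>\<^bsub>lamp_ext T\<^esub> x = \<one>\<^bsub>lamp_ext T\<^esub>"
    using x by (intro bexI[of _ "(shift (- k) A, c \<noteq> cocycle T A A, - k)"]) (auto simp: A)
qed auto

lemma countable_carrier_lamp_ext: "countable (carrier (lamp_ext T))"
proof -
  have "carrier (lamp_ext T) = Collect finite \<times> UNIV"
    by (auto simp: lamp_ext_def)
  then show ?thesis by (simp add: countable_SIGMA countable_Collect_finite)
qed

subsection \<open>A regular language avoiding the identity\<close>

text \<open>
  With initial states \<open>0, 1, 5\<close> and final states \<open>2, 3, 4, 6\<close>, and with \<open>t' = t\<^sup>-\<^sup>1\<close> and \<open>\<epsilon>\<close> the empty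
  word, this automaton accepts the union of \<open>(t\<^sup>* | t'\<^sup>*) a (t | ta)\<^sup>* t'\<^sup>* (z | \<epsilon>)\<close> and
  \<open>(t\<^sup>+ | t'\<^sup>+) (z | \<epsilon>) | z\<close>.  The first part goes to the leftmost lamp, lights it, sweeps to the
  right and lights the other lamps, and ends with the cursor anywhere.  Treating \<open>ta\<close> as a single
  letter forces a move before each further lamp, so the sweep never returns to the leftmost lamp.
\<close>

definition lamp_delta :: "(nat \<times> (int set \<times> bool \<times> int) \<times> nat) set" where
  "lamp_delta =
    (let t = ({}, False, 1); t' = ({}, False, -1); a = ({0}, False, 0);
         ta = ({1}, False, 1); z = ({}, True, 0)
     in {(0, t, 0), (0, a, 2), (1, t', 1), (1, a, 2),
         (2, t, 2), (2, ta, 2), (2, t', 3), (2, z, 4),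
         (3, t', 3), (3, z, 4),
         (5, t', 3), (5, t, 6), (5, z, 4), (6, t, 6), (6, z, 4)})"

lemma lamp_delta_transitions [simp]:
  "(0, ({}, False, 1), 0) \<in> lamp_delta" "(0, ({0}, False, 0), 2) \<in> lamp_delta"
  "(1, ({}, False, -1), 1) \<in> lamp_delta" "(1, ({0}, False, 0), 2) \<in> lamp_delta"
  "(2, ({}, False, 1), 2) \<in> lamp_delta" "(2, ({1}, False, 1), 2) \<in> lamp_delta"
  "(2, ({}, False, -1), 3) \<in> lamp_delta" "(2, ({}, True, 0), 4) \<in> lamp_delta"
  "(3, ({}, False, -1), 3) \<in> lamp_delta" "(3, ({}, True, 0), 4) \<in> lamp_delta"
  "(5, ({}, False, -1), 3) \<in> lamp_delta" "(5, ({}, False, 1), 6) \<in> lamp_delta"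
  "(5, ({}, True, 0), 4) \<in> lamp_delta"
  "(6, ({}, False, 1), 6) \<in> lamp_delta" "(6, ({}, True, 0), 4) \<in> lamp_delta"
  unfolding lamp_delta_def Let_def by (simp_all only: insert_iff simp_thms)

text \<open>
  The clause for state \<open>2\<close> is the heart of the matter: the sweep lights lamps strictly to the right
  of its starting point only, so the lamp lit on entering state \<open>2\<close> from \<open>0\<close> or \<open>1\<close> is never
  switched off again.
\<close>

lemma lamp_spelled_invariant:
  assumes "spelled (lamp_ext T) lamp_delta {2, 3, 4, 6} p g"
  shows "case g of (A, c, k) \<Rightarrow>
     (p = 0 \<longrightarrow> A \<noteq> {}) \<and> (p = 1 \<longrightarrow> A \<noteq> {}) \<and>
     (p = 2 \<longrightarrow> (\<forall>i\<in>A. i \<ge> 1)) \<and>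
     (p = 3 \<longrightarrow> A = {} \<and> k \<le> 0) \<and>
     (p = 4 \<longrightarrow> g = ({}, False, 0)) \<and>
     (p = 5 \<longrightarrow> g \<noteq> ({}, False, 0)) \<and>
     (p = 6 \<longrightarrow> A = {} \<and> k \<ge> 0)"
  using assms
proof induction
  case (spelled_final q)
  then show ?case by auto
next
  case (spelled_step p x q g)
  obtain A c k where g: "g = (A, c, k)" by (cases g)
  show ?case
    using spelled_step.hyps(1) spelled_step.IH unfolding lamp_delta_def Let_def g
    by (simp only: insert_iff empty_iff prod.inject) (elim disjE conjE FalseE; force)
qed

context
  fixes T :: "nat set"
begin

abbreviation spells :: "nat \<Rightarrow> int set \<Rightarrow> bool \<Rightarrow> int \<Rightarrow> bool" where
  "spells p A c k \<equiv> spelled (lamp_ext T) lamp_delta {2, 3, 4, 6} p (A, c, k)"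

lemma spells_t:
  assumes "(p, ({}, False, 1), q) \<in> lamp_delta" "spells q (shift (-1) A) c (k - 1)"
  shows "spells p A c k"
  using spelled_step[OF assms] by simp

lemma spells_t':
  assumes "(p, ({}, False, -1), q) \<in> lamp_delta" "spells q (shift 1 A) c (k + 1)"
  shows "spells p A c k"
  using spelled_step[OF assms] by simp

lemma spells_z:
  assumes "(p, ({}, True, 0), q) \<in> lamp_delta" "spells q A (\<not> c) k"
  shows "spells p A c k"
  using spelled_step[OF assms] by simp

text \<open>
  Lighting a lamp changes the central exponent by an amount that depends on \<open>T\<close>.  The universally
  quantified exponent in the last premise absorbs this amount, so that the spelling lemmas below
  are uniform in \<open>T\<close>.
\<close>

lemma spells_a:
  assumes "(p, ({0}, False, 0), q) \<in> lamp_delta" "0 \<in> A" "\<And>c. spells q (A - {0}) c k"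
  shows "spells p A c k"
proof -
  have "sym_diff {0} (A - {0}) = A" using assms(2) by auto
  moreover have "((False \<noteq> (c \<noteq> b)) \<noteq> b) = c" for b by auto
  ultimately show ?thesis
    using spelled_step[OF assms(1) assms(3)[of "c \<noteq> cocycle T {0} (A - {0})"]]
    by (simp only: lamp_ext_simps shift_shift shift_0) simp
qed

lemma spells_ta:
  assumes "(p, ({1}, False, 1), q) \<in> lamp_delta" "1 \<in> A"
    "\<And>c. spells q (shift (-1) (A - {1})) c (k - 1)"
  shows "spells p A c k"
proof -
  have "sym_diff {1} (A - {1}) = A" using assms(2) by auto
  moreover have "((False \<noteq> (c \<noteq> b)) \<noteq> b) = c" for b by auto
  ultimately show ?thesis
    using spelled_step[OF assms(1) assms(3)[of "c \<noteq> cocycle T {1} (A - {1})"]]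
    by (simp only: lamp_ext_simps shift_shift shift_0) simp
qed

lemma spells_4: "spells 4 {} False 0"
  using spelled_final[of 4 "{2, 3, 4, 6}" "lamp_ext T" lamp_delta] by simp

text \<open>
  The optional \<open>z\<close> at the end of a word corrects the central exponent after everything else has
  been spelled.
\<close>

lemma spells_centre:
  assumes "p \<in> {2, 3, 6}"
  shows "spells p {} c 0"
proof (cases c)
  case True
  have "(p, ({}, True, 0), 4) \<in> lamp_delta" using assms by auto
  then show ?thesis using spells_z spells_4 True by auto
next
  case False
  then show ?thesis
    using spelled_final[of p "{2, 3, 4, 6}" "lamp_ext T" lamp_delta] assms by auto
qed

lemma spells_3: "spells 3 {} c (- int n)"
proof (induction n)
  case 0
  then show ?case using spells_centre[of 3] by simp
next
  case (Suc n)
  show ?case by (rule spells_t'[of 3 3]) (use Suc in \<open>simp_all\<close>)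
qed

lemma spells_6: "spells 6 {} c (int n)"
proof (induction n)
  case 0
  then show ?case using spells_centre[of 6] by simp
next
  case (Suc n)
  show ?case by (rule spells_t[of 6 6]) (use Suc in \<open>simp_all\<close>)
qed

lemma spells_2_no_lamps: "spells 2 {} c k"
proof (cases "k \<ge> 0")
  case True
  have "spells 2 {} c (int n)" for n
  proof (induction n)
    case 0
    then show ?case using spells_centre[of 2] by simp
  next
    case (Suc n)
    show ?case by (rule spells_t[of 2 2]) (use Suc in \<open>simp_all\<close>)
  qed
  from this[of "nat k"] True show ?thesis by simp
next
  case False
  then have "k + 1 = - int (nat (- k - 1))" by simp
  then have prev: "spells 3 {} c (k + 1)" using spells_3 by metis
  show ?thesis by (rule spells_t'[of 2 3]) (simp_all add: prev)
qed

text \<open>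
  The cursor sweeps once from left to right over the window \<open>{1..n}\<close>, reading \<open>ta\<close> where a lamp
  has to be lit and \<open>t\<close> elsewhere.  The window may be longer than needed: the cursor then runs past
  the last lamp and is brought back by \<open>t'\<close>.
\<close>

lemma spells_2: "A \<subseteq> {1..int n} \<Longrightarrow> spells 2 A c k"
proof (induction n arbitrary: A c k)
  case 0
  then show ?case using spells_2_no_lamps by simp
next
  case (Suc n)
  have sub: "shift (-1) (A - {1}) \<subseteq> {1..int n}"
  proof
    fix i assume "i \<in> shift (-1) (A - {1})"
    then have "i + 1 \<in> A" "i + 1 \<noteq> 1" by auto
    with Suc.prems show "i \<in> {1..int n}" by fastforce
  qed
  show ?case
  proof (cases "1 \<in> A")
    case True
    show ?thesis
      by (rule spells_ta[of 2 2]) (use True Suc.IH[OF sub] in \<open>simp_all\<close>)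
  next
    case False
    then have window: "shift (-1) A \<subseteq> {1..int n}" using sub by simp
    show ?thesis
      by (rule spells_t[of 2 2]) (use Suc.IH[OF window] in \<open>simp_all\<close>)
  qed
qed

lemma spells_first_lamp_0:
  assumes "finite A" "0 \<in> A" "\<forall>i\<in>A. i \<ge> 0" "p \<in> {0, 1}"
  shows "spells p A c k"
proof (rule spells_a[of p 2])
  show "(p, ({0}, False, 0), 2) \<in> lamp_delta" using assms(4) by (auto simp del: One_nat_def)
  have "A - {0} \<subseteq> {1..int (nat (Max A))}"
  proof
    fix i assume i: "i \<in> A - {0}"
    then have "i \<le> Max A" "i \<ge> 0" "i \<noteq> 0" using assms by auto
    then show "i \<in> {1..int (nat (Max A))}" by auto
  qed
  then show "spells 2 (A - {0}) c k" for c by (rule spells_2)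
qed (rule assms(2))

text \<open>
  State \<open>0\<close> walks right to a leftmost lamp at a nonnegative position, and state \<open>1\<close> walks left
  to one at a nonpositive position.
\<close>

lemma spells_0:
  "finite A \<Longrightarrow> int n \<in> A \<Longrightarrow> \<forall>i\<in>A. i \<ge> int n \<Longrightarrow> spells 0 A c k"
proof (induction n arbitrary: A k)
  case 0
  then show ?case by (intro spells_first_lamp_0) auto
next
  case (Suc n)
  have prev: "spells 0 (shift (-1) A) c (k - 1)"
  proof (rule Suc.IH)
    show "int n \<in> shift (-1) A" using Suc.prems(2) by (simp add: add.commute)
    show "\<forall>i\<in>shift (-1) A. i \<ge> int n"
    proof
      fix i assume "i \<in> shift (-1) A"
      then have "i + 1 \<ge> int (Suc n)" using Suc.prems(3) by simp
      then show "i \<ge> int n" by simp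
    qed
  qed (use Suc.prems in simp)
  show ?case by (rule spells_t[of 0 0]) (simp_all add: prev)
qed

lemma spells_1:
  "finite A \<Longrightarrow> - int n \<in> A \<Longrightarrow> \<forall>i\<in>A. i \<ge> - int n \<Longrightarrow> spells 1 A c k"
proof (induction n arbitrary: A k)
  case 0
  then show ?case by (intro spells_first_lamp_0) auto
next
  case (Suc n)
  have prev: "spells 1 (shift 1 A) c (k + 1)"
  proof (rule Suc.IH)
    have "- int n - 1 = - int (Suc n)" by simp
    then show "- int n \<in> shift 1 A" using Suc.prems(2) by (simp only: mem_shift)
    show "\<forall>i\<in>shift 1 A. i \<ge> - int n"
    proof
      fix i assume "i \<in> shift 1 A"
      then have "i - 1 \<ge> - int (Suc n)" using Suc.prems(3) by (simp only: mem_shift)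
      then show "i \<ge> - int n" by simp
    qed
  qed (use Suc.prems in simp)
  show ?case by (rule spells_t'[of 1 1]) (simp_all add: prev del: One_nat_def)
qed

lemma spells_lamps:
  assumes "finite A" "A \<noteq> {}"
  shows "\<exists>p\<in>{0, 1}. spells p A c k"
proof -
  have m: "Min A \<in> A" "\<forall>i\<in>A. i \<ge> Min A" using assms by auto
  obtain n where "Min A = int n \<or> Min A = - int n" by (rule int_cases2) auto
  then show ?thesis
  proof
    assume "Min A = int n"
    then have "spells 0 A c k" using m assms(1) by (intro spells_0[of A n]) auto
    then show ?thesis by blast
  next
    assume "Min A = - int n"
    then have "spells 1 A c k" using m assms(1) by (intro spells_1[of A n]) auto
    then show ?thesis by blast
  qed
qed

lemma spells_5:
  assumes "c \<or> k \<noteq> 0"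
  shows "spells 5 {} c k"
proof -
  consider "k > 0" | "k < 0" | "k = 0" "c" using assms by linarith
  then show ?thesis
  proof cases
    case 1
    then have prev: "spells 6 {} c (k - 1)" using spells_6[of c "nat (k - 1)"] by simp
    show ?thesis by (rule spells_t[of 5 6]) (simp_all add: prev)
  next
    case 2
    then have "k + 1 = - int (nat (- k - 1))" by simp
  then have prev: "spells 3 {} c (k + 1)" using spells_3 by metis
    show ?thesis by (rule spells_t'[of 5 3]) (simp_all add: prev)
  next
    case 3
    show ?thesis
      by (rule spells_z[of 5 4]) (use 3 spells_4 in \<open>simp_all\<close>)
  qed
qed

lemma epi_regular_lamp_ext: "epi_regular (lamp_ext T)"
proof (rule epi_regularI[of lamp_delta "{0, 1, 5}" "{2, 3, 4, 6}"])
  show "finite lamp_delta" by (simp add: lamp_delta_def Let_def)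
  show "x \<in> carrier (lamp_ext T)" if "(p, x, q) \<in> lamp_delta" for p x q
    using that by (auto simp: lamp_delta_def Let_def)
  show "\<not> spelled (lamp_ext T) lamp_delta {2, 3, 4, 6} p \<one>\<^bsub>lamp_ext T\<^esub>" if "p \<in> {0, 1, 5}" for p
    using that lamp_spelled_invariant[of T p "\<one>\<^bsub>lamp_ext T\<^esub>"] by auto
  fix g assume g: "g \<in> carrier (lamp_ext T)" "g \<noteq> \<one>\<^bsub>lamp_ext T\<^esub>"
  obtain A c k where "g = (A, c, k)" by (cases g)
  with g show "\<exists>p\<in>{0, 1, 5}. spelled (lamp_ext T) lamp_delta {2, 3, 4, 6} p g"
    using spells_lamps[of A c k] spells_5[of c k] by (cases "A = {}") auto
qed auto

end

subsection \<open>The word problem determines the parameter\<close>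

definition lamp_letters :: "(int set \<times> bool \<times> int) set" where
  "lamp_letters = {({}, False, 1), ({}, False, -1), ({0}, False, 0)}"

text \<open>
  With \<open>d = n + 1\<close> and \<open>a\<^sub>d = t\<^sup>d a t\<^sup>-\<^sup>d\<close>, the probe is the word \<open>(a\<^sub>d a\<^sub>0)\<^sup>2\<close>.  Lamps are
  involutions, so this is the commutator of \<open>a\<^sub>d\<close> and \<open>a\<^sub>0\<close>, whose central exponent records
  whether \<open>n \<in> T\<close>.
\<close>

definition probe :: "nat \<Rightarrow> (int set \<times> bool \<times> int) list" where
  "probe n =
    (let t = replicate (Suc n) ({}, False, 1); t' = replicate (Suc n) ({}, False, -1);
         a = [({0}, False, 0)]
     in t @ a @ t' @ a @ t @ a @ t' @ a)"

lemma probe_letters: "probe n \<in> lists lamp_letters"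
  by (auto simp: probe_def lamp_letters_def Let_def)

lemma word_value_t_pow:
  assumes "word_value (lamp_ext T) w = (A, c, k)"
  shows "word_value (lamp_ext T) (replicate n ({}, False, 1) @ w) = (shift (int n) A, c, k + int n)"
  using assms by (induction n) (auto simp: word_value_def)

lemma word_value_t'_pow:
  assumes "word_value (lamp_ext T) w = (A, c, k)"
  shows "word_value (lamp_ext T) (replicate n ({}, False, -1) @ w) = (shift (- int n) A, c, k - int n)"
  using assms by (induction n) (auto simp: word_value_def)

lemma word_value_a:
  assumes "word_value (lamp_ext T) w = (A, c, k)"
  shows "word_value (lamp_ext T) ([({0}, False, 0)] @ w) =
    (sym_diff {0} A, c \<noteq> cocycle T {0} A, k)"
  using assms by (simp add: word_value_def)

text \<open>
  When the probe is evaluated from right to left, these values occur in the three multiplications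
  by \<open>a\<close> at which some lamp is already lit.  The value
  \<open>n \<in> T\<close> arises once, when \<open>a\<close> at \<open>0\<close> meets the lamp at \<open>- n - 1\<close>; the other products link
  nothing, as no lamp lies to the left of the new one.
\<close>

lemma cocycle_probe:
  "cocycle T {0} {0} = False" "cocycle T {0} {0, int n + 1} = False"
  "cocycle T {0} {- int n - 1} = (n \<in> T)"
proof -
  have "linked_pairs T {0} {0} = {}" "linked_pairs T {0} {0, int n + 1} = {}"
    "linked_pairs T {0} {- int n - 1} = (if n \<in> T then {(0, - int n - 1)} else {})"
    by (auto simp: linked_pairs_def)
  then show "cocycle T {0} {0} = False" "cocycle T {0} {0, int n + 1} = False"
    "cocycle T {0} {- int n - 1} = (n \<in> T)"
    by (simp_all add: cocycle_def)
qed

lemma word_value_probe: "word_value (lamp_ext T) (probe n) = ({}, n \<in> T, 0)"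
proof -
  define val where "val = word_value (lamp_ext T)"
  define t where "t = replicate (Suc n) ({} :: int set, False, 1 :: int)"
  define t' where "t' = replicate (Suc n) ({} :: int set, False, - 1 :: int)"
  define a where "a = [({0} :: int set, False, 0 :: int)]"
  note steps = val_def t_def t'_def a_def
  have "val a = ({0}, False, 0)"
    by (simp add: steps word_value_def)
  then have "val (t' @ a) = ({- int n - 1}, False, - int n - 1)"
    unfolding steps by (subst word_value_t'_pow) auto
  then have "val (a @ t' @ a) = ({0, - int n - 1}, n \<in> T, - int n - 1)"
    unfolding steps by (subst word_value_a) (auto simp: cocycle_probe)
  then have "val (t @ a @ t' @ a) = ({0, int n + 1}, n \<in> T, 0)"
    unfolding steps by (subst word_value_t_pow) auto
  then have "val (a @ t @ a @ t' @ a) = ({int n + 1}, n \<in> T, 0)"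
    unfolding steps by (subst word_value_a) (auto simp: cocycle_probe)
  then have "val (t' @ a @ t @ a @ t' @ a) = ({0}, n \<in> T, - int n - 1)"
    unfolding steps by (subst word_value_t'_pow) auto
  then have "val (a @ t' @ a @ t @ a @ t' @ a) = ({}, n \<in> T, - int n - 1)"
    unfolding steps by (subst word_value_a) (auto simp: cocycle_probe)
  then have "val (t @ a @ t' @ a @ t @ a @ t' @ a) = ({}, n \<in> T, 0)"
    unfolding steps by (subst word_value_t_pow) auto
  then show ?thesis by (simp add: steps probe_def Let_def)
qed

lemma inj_coWP_lamp_ext: "inj (\<lambda>T. coWP (lamp_ext T) lamp_letters)"
proof (rule injI)
  fix S T assume eq: "coWP (lamp_ext S) lamp_letters = coWP (lamp_ext T) lamp_letters"
  have "probe n \<in> coWP (lamp_ext R) lamp_letters \<longleftrightarrow> n \<in> R" for n R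
    by (simp add: coWP_def word_value_probe probe_letters)
  with eq show "S = T" by blast
qed

lemma uncountable_nat_sets: "uncountable (UNIV :: nat set set)"
proof
  assume "countable (UNIV :: nat set set)"
  then have "range (from_nat_into (UNIV :: nat set set)) = UNIV"
    by (intro range_from_nat_into) auto
  then show False using Cantors_theorem[of "UNIV :: nat set"] by (metis Pow_UNIV)
qed

theorem corollary2p1:
  shows "\<exists>G :: nat monoid. group G \<and> epi_regular G \<and> epi_CF G \<and> \<not> coCF G"
proof -
  let ?C = "carrier (lamp_ext {})"
  \<comment> \<open>All the groups have the same carrier, so one numbering of it transports them all and sends the
    letters to the same natural numbers for every \<open>T\<close>.\<close>
  define \<phi> where "\<phi> = to_nat_on ?C"
  define G where "G = (\<lambda>T. image_group \<phi> (lamp_ext T))"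
  have C: "carrier (lamp_ext T) = ?C" for T by (simp add: lamp_ext_def)
  have inj: "inj_on \<phi> (carrier (lamp_ext T))" for T
    unfolding \<phi>_def C[of T] by (intro inj_on_to_nat_on countable_carrier_lamp_ext)
  have grp: "group (G T)" for T
    unfolding G_def by (intro group.inj_imp_image_group_is_group group_lamp_ext inj)
  have iso: "\<phi> \<in> iso (lamp_ext T) (G T)" for T
    unfolding G_def by (intro inj_imp_image_group_iso inj)
  have reg: "epi_regular (G T)" for T
    by (rule epi_regular_iso[OF group_lamp_ext grp iso epi_regular_lamp_ext])
  have letters: "lamp_letters \<subseteq> carrier (lamp_ext T)" for T
    by (auto simp: lamp_letters_def)
  have mem: "map \<phi> w \<in> coWP (G T) (\<phi> ` lamp_letters) \<longleftrightarrow> w \<in> coWP (lamp_ext T) lamp_letters"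
    if w: "w \<in> lists lamp_letters" for T w
  proof -
    interpret H: group "lamp_ext T" by (rule group_lamp_ext)
    have wc: "w \<in> lists (carrier (lamp_ext T))" using w letters by blast
    have one: "\<phi> \<one>\<^bsub>lamp_ext T\<^esub> = \<one>\<^bsub>G T\<^esub>" by (simp add: G_def image_group_one)
    have "word_value (G T) (map \<phi> w) = \<phi> (word_value (lamp_ext T) w)"
      using word_value_iso[OF H.monoid_axioms iso one wc] .
    then have "word_value (G T) (map \<phi> w) = \<one>\<^bsub>G T\<^esub> \<longleftrightarrow>
        word_value (lamp_ext T) w = \<one>\<^bsub>lamp_ext T\<^esub>"
      using inj_onD[OF inj _ H.word_value_closed[OF wc] H.one_closed] one by metis
    with w show ?thesis by (auto simp: coWP_def)
  qed
  have inj_coWP: "inj (\<lambda>T. coWP (G T) (\<phi> ` lamp_letters))"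
  proof (rule injI)
    fix S T assume "coWP (G S) (\<phi> ` lamp_letters) = coWP (G T) (\<phi> ` lamp_letters)"
    then have "w \<in> coWP (lamp_ext S) lamp_letters \<longleftrightarrow> w \<in> coWP (lamp_ext T) lamp_letters"
      if "w \<in> lists lamp_letters" for w
      using mem[OF that] by blast
    then have "coWP (lamp_ext S) lamp_letters = coWP (lamp_ext T) lamp_letters"
      by (auto simp: coWP_def)
    then show "S = T" using inj_coWP_lamp_ext by (auto dest: injD)
  qed
  have "\<exists>T. \<not> coCF (G T)"
  proof (rule ccontr)
    assume all: "\<nexists>T. \<not> coCF (G T)"
    have "finite (\<phi> ` lamp_letters)" by (simp add: lamp_letters_def)
    then obtain \<D> where \<D>: "countable \<D>" "\<And>H :: nat monoid.
        monoid H \<Longrightarrow> \<phi> ` lamp_letters \<subseteq> carrier H \<Longrightarrow> coCF H \<Longrightarrow> coWP H (\<phi> ` lamp_letters) \<in> \<D>"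
      using countable_coWP_of_coCF[of "\<phi> ` lamp_letters"] by blast
    have "\<phi> ` lamp_letters \<subseteq> carrier (G T)" for T
      using letters by (auto simp: G_def image_group_carrier)
    then have "range (\<lambda>T. coWP (G T) (\<phi> ` lamp_letters)) \<subseteq> \<D>"
      using \<D>(2) all grp by (auto simp: group_def)
    then have "countable (range (\<lambda>T. coWP (G T) (\<phi> ` lamp_letters)))"
      using \<D>(1) countable_subset by blast
    then show False
      using countable_image_inj_on inj_coWP uncountable_nat_sets by blast
  qed
  then show ?thesis using grp reg epi_regular_imp_epi_CF by blast
qed

end
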